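(* Let $(L,\sigma)$ be a quadratic pair with $k=L_\sigma$, $\operatorname{char}(k)\ne2$, and quadratic form $q(\ell)=\ell\ell^\sigma$ on $L$, and let $(L,\sigma,X,h,\pi)$ be a non-zero standard anisotropic pseudo-quadratic space. Let $J=\mathcal H(M_2(L),\sigma t)$, $e_0,e_1,u$, $J_{1/2}$, $Q$, $\widetilde X=X^2$, the action $\bullet$ of $J$ on $\widetilde X$, $\beta:\widetilde X\times\widetilde X\to J$ and $\widetilde X_0=\{[x,0]\mid x\in X\}$ be as in the context. Then $\widetilde X$ is a non-trivial special $J$-module, $\beta$ is a skew-symmetric bilinear form satisfying $$U_j\beta(x,y)=\beta(j\bullet x,j\bullet y)\quad\text{and equivalently}\quad j\,\beta(x,y)=\tfrac12\bigl(\beta(j\bullet x,y)+\beta(x,j\bullet y)\bigr)\qquad (j\in J,\ x,y\in\widetilde X),$$ and moreover $$\beta(v\bullet x,x)\bullet x=v\bullet\bigl(u\bullet(\beta(u\bullet x,x)\bullet x)\bigr)\ \text{ for all }x\in\widetilde X_0,\ v\in J_{1/2},\qquad \beta(u\bullet x,x)\ne0\ \text{ for all }x\in\widetilde X_0\setminus\{0\}.$$ Under the identifications $$J_{1/2}\cong L:\ \begin{bmatrix}0&\ell^\sigma\\ \ell&0\end{bmatrix}\leftrightarrow\ell,\qquad \widetilde X_0\cong X:\ [x,0]\leftrightarrow x,$$ the quadrangular algebra $(k,J_{1/2},Q,u,\widetilde X_0,\cdot,\widetilde h)$ defined by $x\cdot v:=v\bullet(u\bullet x)$ and $\widetilde h(x,y):=\beta(u\bullet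 x,y)$ is exactly the quadrangular algebra $(k,L,q,1,X,\text{scalar multiplication},h)$ given by the pseudo-quadratic space.
   Context: A quadratic pair is a skew field $L$ with involution $\sigma$ such that $k:=L_\sigma=\{\ell\in L\mid\ell^\sigma=\ell\}$ is a field and either $L/k$ is a separable quadratic field extension with $\sigma$ the generator of the Galois group, or $L$ is a quaternion algebra over $k$ with standard involution $\sigma$. A standard pseudo-quadratic space $(L,\sigma,X,h,\pi)$ (characteristic not 2): $X$ a right $L$-vector space, $h:X\times X\to L$ skew-hermitian, i.e. bi-additive with $h(x,yu)=h(x,y)u$ and $h(x,y)^\sigma=-h(y,x)$, and $\pi(x)=\tfrac12h(x,x)$. It is anisotropic if $\pi(x)\in L_\sigma$ only for $x=0$. A non-zero standard anisotropic pseudo-quadratic space over a quadratic pair gives the quadrangular algebra $(k,L,q,1,X,\text{scalar multiplication},h)$. A Jordan algebra is a unital commutative algebra with $(x^2y)x=x^2(yx)$; $U_xy:=2x(xy)-x^2y$. $J=\mathcal H(M_2(L),\sigma t)=\left\{\begin{bmatrix}\alpha_1&\ell^\sigma\\ \ell&\alpha_2\end{bmatrix}\mid\alpha_1,\alpha_2\in L_\sigma,\ \ell\in L\right\}$, a Jordan $k$-algebra with product $\tfrac12(mn+nm)$ (matrix products). $e_0=\begin{bmatrix}1&0\\0&0\end{bmatrix}$, $e_1=\begin{bmatrix}0&0\\0&1\end{bmatrix}$, $u=\begin{bmatrix}0&1\\1&0\end{bmatrix}$; $J_{1/2}=\left\{\begin{bmatrix}0&\ell^\sigma\\ \ell&0\end{bmatrix}\mid\ell\in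 L\right\}$ and $Q\left(\begin{bmatrix}0&\ell^\sigma\\ \ell&0\end{bmatrix}\right)=q(\ell)$, so that $u$ is a base point of $Q$ ($J$ is the reduced spin factor of $Q$). $\widetilde X=X^2$ is the space of $1\times2$ row vectors over $X$, $j\bullet x:=xj$ (matrix multiplication), and $$\beta([x_1,x_2],[y_1,y_2])=\begin{bmatrix}h(x_1,y_1)-h(y_1,x_1)&h(x_1,y_2)-h(y_1,x_2)\\ h(x_2,y_1)-h(y_2,x_1)&h(x_2,y_2)-h(y_2,x_2)\end{bmatrix}.$$ A special $J$-module is a $k$-vector space $X$ with a $k$-bilinear action $\bullet:J\times X\to X$ such that $1\bullet x=x$ and $(U_jj')\bullet x=j\bullet(j'\bullet(j\bullet x))$. A quadrangular algebra (over $k$ with $\operatorname{char}(k)\ne2$) is a 7-tuple $(k,L,q,1,X,\cdot,h)$ with $L$ a $k$-vector space, $q:L\to k$ an anisotropic quadratic form, $1\in L$ with $q(1)=1$, $X$ a nontrivial $k$-vector space, and maps $X\times L\to X:(x,v)\mapsto x\cdot v$ (also written $xv$), $h:X\times X\to L$ such that, with $f(v,w)=q(v+w)-q(v)-q(w)$, $v^\sigma=f(1,v)1-v$, $v^{-1}=v^\sigma/q(v)$, for all $x,y\in X$, $v\in L$: (A1) $\cdot$ is $k$-bilinear; (A2) $x\cdot1=x$; (A3) $(xv)v^{-1}=x$ for $v\ne0$; (B1) $h$ is $k$-bilinear; (B2) $h(x,yv)=h(y,xv)+f(h(x,y),1)v$; (B3) $f(h(xv,y),1)=f(h(x,y),v)$;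 (C) $\theta(x,v):=\tfrac12h(x,xv)$; (D1) with $\pi(x)=\theta(x,1)$, $x\theta(x,v)=(x\pi(x))v$; (D2) $\pi(x)\ne0$ for $x\ne0$. *)

theory Defs
  imports "HOL-Analysis.Cartesian_Space"
begin

text \<open>
  A skew field \<open>L\<close> is a type of class \<^class>\<open>division_ring\<close>. The field \<open>k\<close> is a subset of it, so vector
  spaces over \<open>k\<close>, and the structures built on them, have explicit carriers.
\<close>

section \<open>Vector spaces and forms over a subfield\<close>

definition is_subfield :: "'k::division_ring set \<Rightarrow> bool" where
  "is_subfield K \<longleftrightarrow>
     0 \<in> K \<and> 1 \<in> K \<and> (\<forall>a\<in>K. \<forall>b\<in>K. a + b \<in> K \<and> a * b \<in> K) \<and>
     (\<forall>a\<in>K. - a \<in> K \<and> inverse a \<in> K) \<and> (\<forall>a\<in>K. \<forall>b\<in>K. a * b = b * a)"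

locale vector_space_over =
  fixes K :: "'k::division_ring set" and V :: "'v::ab_group_add set"
    and scale :: "'k \<Rightarrow> 'v \<Rightarrow> 'v"
  assumes subfield: "is_subfield K"
    and zero_closed: "0 \<in> V"
    and add_closed: "v \<in> V \<Longrightarrow> w \<in> V \<Longrightarrow> v + w \<in> V"
    and uminus_closed: "v \<in> V \<Longrightarrow> - v \<in> V"
    and scale_closed: "c \<in> K \<Longrightarrow> v \<in> V \<Longrightarrow> scale c v \<in> V"
    and scale_right_distrib: "c \<in> K \<Longrightarrow> v \<in> V \<Longrightarrow> w \<in> V \<Longrightarrow> scale c (v + w) = scale c v + scale c w"
    and scale_left_distrib: "c \<in> K \<Longrightarrow> d \<in> K \<Longrightarrow> v \<in> V \<Longrightarrow> scale (c + d) v = scale c v + scale d v"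
    and scale_scale: "c \<in> K \<Longrightarrow> d \<in> K \<Longrightarrow> v \<in> V \<Longrightarrow> scale c (scale d v) = scale (c * d) v"
    and scale_one: "v \<in> V \<Longrightarrow> scale 1 v = v"

definition linear_over ::
  "'k set \<Rightarrow> 'v::ab_group_add set \<Rightarrow> ('k \<Rightarrow> 'v \<Rightarrow> 'v) \<Rightarrow>
   'w::ab_group_add set \<Rightarrow> ('k \<Rightarrow> 'w \<Rightarrow> 'w) \<Rightarrow> ('v \<Rightarrow> 'w) \<Rightarrow> bool" where
  "linear_over K V sV W sW g \<longleftrightarrow>
     (\<forall>v\<in>V. g v \<in> W) \<and>
     (\<forall>v\<in>V. \<forall>v'\<in>V. g (v + v') = g v + g v') \<and>
     (\<forall>c\<in>K. \<forall>v\<in>V. g (sV c v) = sW c (g v))"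

definition bilinear_over ::
  "'k set \<Rightarrow> 'v::ab_group_add set \<Rightarrow> ('k \<Rightarrow> 'v \<Rightarrow> 'v) \<Rightarrow>
   'w::ab_group_add set \<Rightarrow> ('k \<Rightarrow> 'w \<Rightarrow> 'w) \<Rightarrow>
   'z::ab_group_add set \<Rightarrow> ('k \<Rightarrow> 'z \<Rightarrow> 'z) \<Rightarrow> ('v \<Rightarrow> 'w \<Rightarrow> 'z) \<Rightarrow> bool" where
  "bilinear_over K V sV W sW Z sZ g \<longleftrightarrow>
     (\<forall>w\<in>W. linear_over K V sV Z sZ (\<lambda>v. g v w)) \<and>
     (\<forall>v\<in>V. linear_over K W sW Z sZ (\<lambda>w. g v w))"

definition polar_form :: "('v::ab_group_add \<Rightarrow> 'k::ab_group_add) \<Rightarrow> 'v \<Rightarrow> 'v \<Rightarrow> 'k" where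
  "polar_form q v w = q (v + w) - q v - q w"

definition quadratic_form_over ::
  "'k::division_ring set \<Rightarrow> 'v::ab_group_add set \<Rightarrow> ('k \<Rightarrow> 'v \<Rightarrow> 'v) \<Rightarrow> ('v \<Rightarrow> 'k) \<Rightarrow> bool" where
  "quadratic_form_over K V sV q \<longleftrightarrow>
     (\<forall>v\<in>V. q v \<in> K) \<and>
     (\<forall>c\<in>K. \<forall>v\<in>V. q (sV c v) = c\<^sup>2 * q v) \<and>
     bilinear_over K V sV V sV K (*) (polar_form q)"

section \<open>Quadratic pairs\<close>

definition ring_involution :: "('l::division_ring \<Rightarrow> 'l) \<Rightarrow> bool" where
  "ring_involution \<sigma> \<longleftrightarrow>
     (\<forall>a b. \<sigma> (a + b) = \<sigma> a + \<sigma> b) \<and> (\<forall>a b. \<sigma> (a * b) = \<sigma> b * \<sigma> a) \<and> (\<forall>a. \<sigma> (\<sigma> a) = a)"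

definition fixed_set :: "('l \<Rightarrow> 'l) \<Rightarrow> 'l set" where
  "fixed_set \<sigma> = {l. \<sigma> l = l}"

text \<open>
  The last clause is separability: an element \<open>a\<close> outside \<open>K\<close> has a minimal polynomial of degree 2,
  which splits over \<open>L\<close> as \<open>(X - a) (X - b)\<close>; the coefficients lie in \<open>K\<close> and the roots are distinct.
\<close>

definition separable_quadratic_field_extension :: "'l::division_ring set \<Rightarrow> bool" where
  "separable_quadratic_field_extension K \<longleftrightarrow>
     (\<forall>a b :: 'l. a * b = b * a) \<and>
     (\<exists>b\<^sub>1 b\<^sub>2. \<forall>l. \<exists>!(c\<^sub>1, c\<^sub>2). c\<^sub>1 \<in> K \<and> c\<^sub>2 \<in> K \<and> l = c\<^sub>1 * b\<^sub>1 + c\<^sub>2 * b\<^sub>2) \<and>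
     (\<forall>a. a \<notin> K \<longrightarrow> (\<exists>b. b \<noteq> a \<and> a + b \<in> K \<and> a * b \<in> K))"

definition galois_group :: "'l::division_ring set \<Rightarrow> ('l \<Rightarrow> 'l) set" where
  "galois_group K =
     {\<tau>. bij \<tau> \<and> (\<forall>a b. \<tau> (a + b) = \<tau> a + \<tau> b) \<and> (\<forall>a b. \<tau> (a * b) = \<tau> a * \<tau> b) \<and> (\<forall>c\<in>K. \<tau> c = c)}"

text \<open>
  The presentation by generators \<open>i, j\<close> with \<open>i\<^sup>2, j\<^sup>2 \<in> K\<^sup>\<times>\<close> and \<open>j i = - i j\<close> is the definition of
  a quaternion algebra in characteristic different from 2.
\<close>

definition quaternion_algebra_with_standard_involution ::
  "'l::division_ring set \<Rightarrow> ('l \<Rightarrow> 'l) \<Rightarrow> bool" where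
  "quaternion_algebra_with_standard_involution K \<sigma> \<longleftrightarrow>
     (\<forall>c\<in>K. \<forall>l. c * l = l * c) \<and>
     (\<exists>i j. i * i \<in> K - {0} \<and> j * j \<in> K - {0} \<and> j * i = - (i * j) \<and>
        (\<forall>l. \<exists>!(c\<^sub>0, c\<^sub>1, c\<^sub>2, c\<^sub>3). c\<^sub>0 \<in> K \<and> c\<^sub>1 \<in> K \<and> c\<^sub>2 \<in> K \<and> c\<^sub>3 \<in> K \<and>
           l = c\<^sub>0 + c\<^sub>1 * i + c\<^sub>2 * j + c\<^sub>3 * (i * j)) \<and>
        (\<forall>c\<^sub>0\<in>K. \<forall>c\<^sub>1\<in>K. \<forall>c\<^sub>2\<in>K. \<forall>c\<^sub>3\<in>K.
           \<sigma> (c\<^sub>0 + c\<^sub>1 * i + c\<^sub>2 * j + c\<^sub>3 * (i * j)) = c\<^sub>0 - c\<^sub>1 * i - c\<^sub>2 * j - c\<^sub>3 * (i * j)))"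

definition quadratic_pair :: "('l::division_ring \<Rightarrow> 'l) \<Rightarrow> bool" where
  "quadratic_pair \<sigma> \<longleftrightarrow>
     ring_involution \<sigma> \<and> is_subfield (fixed_set \<sigma>) \<and>
     (separable_quadratic_field_extension (fixed_set \<sigma>) \<and>
        galois_group (fixed_set \<sigma>) = range (\<lambda>n::nat. \<sigma> ^^ n) \<or>
      quaternion_algebra_with_standard_involution (fixed_set \<sigma>) \<sigma>)"

definition norm_form :: "('l::division_ring \<Rightarrow> 'l) \<Rightarrow> 'l \<Rightarrow> 'l" where
  "norm_form \<sigma> l = l * \<sigma> l"

section \<open>Pseudo-quadratic spaces\<close>

locale right_vector_space =
  fixes rscale :: "'x::ab_group_add \<Rightarrow> 'l::division_ring \<Rightarrow> 'x"
  assumes rscale_left_distrib: "rscale (x + y) a = rscale x a + rscale y a"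
    and rscale_right_distrib: "rscale x (a + b) = rscale x a + rscale x b"
    and rscale_rscale: "rscale (rscale x a) b = rscale x (a * b)"
    and rscale_one: "rscale x 1 = x"

locale standard_pseudo_quadratic_space = right_vector_space rscale
  for rscale :: "'x::ab_group_add \<Rightarrow> 'l::division_ring \<Rightarrow> 'x" +
  fixes \<sigma> :: "'l \<Rightarrow> 'l" and h :: "'x \<Rightarrow> 'x \<Rightarrow> 'l" and \<pi> :: "'x \<Rightarrow> 'l"
  assumes char_not_2: "(2::'l) \<noteq> 0"
    and involution: "ring_involution \<sigma>"
    and h_add_left: "h (x + y) z = h x z + h y z"
    and h_add_right: "h x (y + z) = h x y + h x z"
    and h_rscale: "h x (rscale y a) = h x y * a"
    and h_skew: "\<sigma> (h x y) = - h y x"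
    and pi_eq: "\<pi> x = inverse 2 * h x x"

definition anisotropic_pseudo_quadratic ::
  "('l::division_ring \<Rightarrow> 'l) \<Rightarrow> ('x::ab_group_add \<Rightarrow> 'l) \<Rightarrow> bool" where
  "anisotropic_pseudo_quadratic \<sigma> \<pi> \<longleftrightarrow> (\<forall>x. \<pi> x \<in> fixed_set \<sigma> \<longrightarrow> x = 0)"

section \<open>Jordan algebras and special modules\<close>

locale jordan_algebra = vector_space_over K J sJ
  for K :: "'k::division_ring set" and J :: "'j::ab_group_add set" and sJ :: "'k \<Rightarrow> 'j \<Rightarrow> 'j" +
  fixes jmult :: "'j \<Rightarrow> 'j \<Rightarrow> 'j" and unit :: 'j
  assumes jmult_bilinear: "bilinear_over K J sJ J sJ J sJ jmult"
    and unit_closed: "unit \<in> J"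
    and unit_jmult: "x \<in> J \<Longrightarrow> jmult unit x = x"
    and jmult_commute: "x \<in> J \<Longrightarrow> y \<in> J \<Longrightarrow> jmult x y = jmult y x"
    and jordan_identity:
      "x \<in> J \<Longrightarrow> y \<in> J \<Longrightarrow> jmult (jmult (jmult x x) y) x = jmult (jmult x x) (jmult y x)"

definition jordan_U :: "('j::ab_group_add \<Rightarrow> 'j \<Rightarrow> 'j) \<Rightarrow> 'j \<Rightarrow> 'j \<Rightarrow> 'j" where
  "jordan_U jmult x y = (jmult x (jmult x y) + jmult x (jmult x y)) - jmult (jmult x x) y"

locale special_jordan_module =
  jordan_algebra K J sJ jmult unit + X: vector_space_over K X sX
  for K :: "'k::division_ring set"
    and J :: "'j::ab_group_add set" and sJ :: "'k \<Rightarrow> 'j \<Rightarrow> 'j"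
    and jmult :: "'j \<Rightarrow> 'j \<Rightarrow> 'j" and unit :: 'j
    and X :: "'x::ab_group_add set" and sX :: "'k \<Rightarrow> 'x \<Rightarrow> 'x" +
  fixes act :: "'j \<Rightarrow> 'x \<Rightarrow> 'x"
  assumes act_bilinear: "bilinear_over K J sJ X sX X sX act"
    and act_unit: "x \<in> X \<Longrightarrow> act unit x = x"
    and act_U: "j \<in> J \<Longrightarrow> j' \<in> J \<Longrightarrow> x \<in> X \<Longrightarrow>
      act (jordan_U jmult j j') x = act j (act j' (act j x))"

section \<open>Quadrangular algebras in characteristic different from 2\<close>

definition qa_sigma ::
  "('k::division_ring \<Rightarrow> 'v::ab_group_add \<Rightarrow> 'v) \<Rightarrow> ('v \<Rightarrow> 'k) \<Rightarrow> 'v \<Rightarrow> 'v \<Rightarrow> 'v" where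
  "qa_sigma sL q one v = sL (polar_form q one v) one - v"

definition qa_inverse ::
  "('k::division_ring \<Rightarrow> 'v::ab_group_add \<Rightarrow> 'v) \<Rightarrow> ('v \<Rightarrow> 'k) \<Rightarrow> 'v \<Rightarrow> 'v \<Rightarrow> 'v" where
  "qa_inverse sL q one v = sL (inverse (q v)) (qa_sigma sL q one v)"

definition qa_theta ::
  "('k::division_ring \<Rightarrow> 'v \<Rightarrow> 'v) \<Rightarrow> ('x \<Rightarrow> 'v \<Rightarrow> 'x) \<Rightarrow> ('x \<Rightarrow> 'x \<Rightarrow> 'v) \<Rightarrow> 'x \<Rightarrow> 'v \<Rightarrow> 'v" where
  "qa_theta sL act h x v = sL (inverse 2) (h x (act x v))"

locale quadrangular_algebra =
  L: vector_space_over K L sL + X: vector_space_over K X sX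
  for K :: "'k::division_ring set"
    and L :: "'v::ab_group_add set" and sL :: "'k \<Rightarrow> 'v \<Rightarrow> 'v"
    and X :: "'x::ab_group_add set" and sX :: "'k \<Rightarrow> 'x \<Rightarrow> 'x" +
  fixes q :: "'v \<Rightarrow> 'k" and one :: 'v
    and act :: "'x \<Rightarrow> 'v \<Rightarrow> 'x" and h :: "'x \<Rightarrow> 'x \<Rightarrow> 'v"
  assumes char_not_2: "(2::'k) \<noteq> 0"
    and q_form: "quadratic_form_over K L sL q"
    and q_anisotropic: "v \<in> L \<Longrightarrow> q v = 0 \<Longrightarrow> v = 0"
    and one_closed: "one \<in> L"
    and q_one: "q one = 1"
    and nontrivial: "\<exists>x\<in>X. x \<noteq> 0"
    and A1: "bilinear_over K X sX L sL X sX act"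
    and A2: "x \<in> X \<Longrightarrow> act x one = x"
    and A3: "x \<in> X \<Longrightarrow> v \<in> L \<Longrightarrow> v \<noteq> 0 \<Longrightarrow> act (act x v) (qa_inverse sL q one v) = x"
    and B1: "bilinear_over K X sX X sX L sL h"
    and B2: "x \<in> X \<Longrightarrow> y \<in> X \<Longrightarrow> v \<in> L \<Longrightarrow>
      h x (act y v) = h y (act x v) + sL (polar_form q (h x y) one) v"
    and B3: "x \<in> X \<Longrightarrow> y \<in> X \<Longrightarrow> v \<in> L \<Longrightarrow>
      polar_form q (h (act x v) y) one = polar_form q (h x y) v"
    and D1: "x \<in> X \<Longrightarrow> v \<in> L \<Longrightarrow>
      act x (qa_theta sL act h x v) = act (act x (qa_theta sL act h x one)) v"
    and D2: "x \<in> X \<Longrightarrow> x \<noteq> 0 \<Longrightarrow> qa_theta sL act h x one \<noteq> 0"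

text \<open>
  The maps \<open>\<phi> : L \<rightarrow> L'\<close> and \<open>\<psi> : X \<rightarrow> X'\<close> identify the two 7-tuples over the same field \<open>K\<close>,
  matching every component.
\<close>

definition identifies_quadrangular_algebras where
  "identifies_quadrangular_algebras K L sL X sX q one act h L' sL' X' sX' q' one' act' h' \<phi> \<psi> \<longleftrightarrow>
     bij_betw \<phi> L L' \<and> linear_over K L sL L' sL' \<phi> \<and>
     bij_betw \<psi> X X' \<and> linear_over K X sX X' sX' \<psi> \<and>
     (\<forall>v\<in>L. q' (\<phi> v) = q v) \<and>
     \<phi> one = one' \<and>
     (\<forall>x\<in>X. \<forall>v\<in>L. \<psi> (act x v) = act' (\<psi> x) (\<phi> v)) \<and>
     (\<forall>x\<in>X. \<forall>y\<in>X. \<phi> (h x y) = h' (\<psi> x) (\<psi> y))"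

section \<open>Hermitian matrices of size 2 and row vectors\<close>

definition mat2 :: "'l::zero \<Rightarrow> 'l \<Rightarrow> 'l \<Rightarrow> 'l \<Rightarrow> 'l^2^2" where
  "mat2 a b c d = vector [vector [a, b], vector [c, d]]"

definition hermitian_mat2 :: "('l::division_ring \<Rightarrow> 'l) \<Rightarrow> ('l^2^2) set" where
  "hermitian_mat2 \<sigma> =
     {mat2 \<alpha>\<^sub>1 (\<sigma> l) l \<alpha>\<^sub>2 | \<alpha>\<^sub>1 \<alpha>\<^sub>2 l. \<alpha>\<^sub>1 \<in> fixed_set \<sigma> \<and> \<alpha>\<^sub>2 \<in> fixed_set \<sigma>}"

definition mat2_scale :: "'l::division_ring \<Rightarrow> 'l^2^2 \<Rightarrow> 'l^2^2" where
  "mat2_scale c m = (\<chi> i j. c * m $ i $ j)"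

definition mat2_jmult :: "'l::division_ring^2^2 \<Rightarrow> 'l^2^2 \<Rightarrow> 'l^2^2" where
  "mat2_jmult m n = mat2_scale (inverse 2) (m ** n + n ** m)"

definition off_diag :: "('l::division_ring \<Rightarrow> 'l) \<Rightarrow> 'l \<Rightarrow> 'l^2^2" where
  "off_diag \<sigma> l = mat2 0 (\<sigma> l) l 0"

definition J_half :: "('l::division_ring \<Rightarrow> 'l) \<Rightarrow> ('l^2^2) set" where
  "J_half \<sigma> = range (off_diag \<sigma>)"

definition u_mat :: "'l::division_ring^2^2" where
  "u_mat = mat2 0 1 1 0"

text \<open>On \<^term>\<open>J_half \<sigma>\<close> this is \<open>Q (off_diag \<sigma> l) = q l\<close>: the entry of index \<open>(2, 1)\<close> is \<open>l\<close>.\<close>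

definition Q_half :: "('l::division_ring \<Rightarrow> 'l) \<Rightarrow> 'l^2^2 \<Rightarrow> 'l" where
  "Q_half \<sigma> m = norm_form \<sigma> (m $ 2 $ 1)"

definition row_scale :: "('x::ab_group_add \<Rightarrow> 'l \<Rightarrow> 'x) \<Rightarrow> 'l::division_ring \<Rightarrow> 'x^2 \<Rightarrow> 'x^2" where
  "row_scale rscale c x = (\<chi> i. rscale (x $ i) c)"

definition row_act :: "('x::ab_group_add \<Rightarrow> 'l \<Rightarrow> 'x) \<Rightarrow> 'l::division_ring^2^2 \<Rightarrow> 'x^2 \<Rightarrow> 'x^2" where
  "row_act rscale j x = (\<chi> n. \<Sum>m\<in>UNIV. rscale (x $ m) (j $ m $ n))"

definition row_beta :: "('x \<Rightarrow> 'x \<Rightarrow> 'l::division_ring) \<Rightarrow> 'x^2 \<Rightarrow> 'x^2 \<Rightarrow> 'l^2^2" where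
  "row_beta h x y =
     mat2 (h (x$1) (y$1) - h (y$1) (x$1)) (h (x$1) (y$2) - h (y$1) (x$2))
          (h (x$2) (y$1) - h (y$2) (x$1)) (h (x$2) (y$2) - h (y$2) (x$2))"

definition first_row :: "'x::zero \<Rightarrow> 'x^2" where
  "first_row x = vector [x, 0]"

definition row_zero_part :: "('x::zero^2) set" where
  "row_zero_part = range first_row"

end

theory Submission
  imports Defs
begin

text \<open>
  Because \<open>k\<close> is central in \<open>L\<close>, the Jordan product \<open>(mn + nm)/2\<close> of hermitian matrices satisfies
  \<open>U\<^sub>j m = j m j\<close>, so that right multiplication of row vectors is a special module; and
  sesquilinearity of \<open>h\<close> turns \<open>\<beta>(xj, yj)\<close> into \<open>j \<beta>(x, y) j\<close>. The quadrangular algebra axioms for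
  \<open>L\<close> are formal except for (B3), which says that the trace satisfies \<open>T(ab) = T(ba)\<close>: this is the
  polarised form of \<open>\<ell> \<ell>\<^sup>\<sigma> = \<ell>\<^sup>\<sigma> \<ell>\<close>. The quadrangular algebra on \<open>J\<^sub>1\<^sub>/\<^sub>2\<close> is obtained by transport.
\<close>

text \<open>The factor one half is kept as \<open>inverse 2\<close> throughout, the form in which
  the definitions and the lemmas on scaling state it.\<close>

declare inverse_eq_divide_numeral [simp del]

section \<open>Transport of quadrangular algebras\<close>

lemma is_subfield_half:
  assumes "is_subfield K"
  shows "inverse 2 \<in> K"
proof -
  have "1 + 1 \<in> K"
    using assms unfolding is_subfield_def by blast
  then have "inverse (1 + 1) \<in> K"
    using assms unfolding is_subfield_def by blast
  then show ?thesis
    by (simp only: one_add_one)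
qed

text \<open>The axioms speak only of the seven components and of operations derived from them. A
  bijective matching of the components therefore carries them over, once it is seen to respect the
  polar form, \<open>qa_inverse\<close> and \<open>qa_theta\<close>.\<close>

lemma quadrangular_algebra_transport:
  assumes qa: "quadrangular_algebra K L sL X sX q one act h"
    and L': "vector_space_over K L' sL'" and X': "vector_space_over K X' sX'"
    and iden: "identifies_quadrangular_algebras K L sL X sX q one act h
      L' sL' X' sX' q' one' act' h' \<phi> \<psi>"
  shows "quadrangular_algebra K L' sL' X' sX' q' one' act' h'"
proof -
  interpret A: quadrangular_algebra K L sL X sX q one act h by (fact qa)
  interpret L': vector_space_over K L' sL' by (fact L')
  interpret X': vector_space_over K X' sX' by (fact X')
  have L'_eq: "L' = \<phi> ` L" and inj_phi: "inj_on \<phi> L" and X'_eq: "X' = \<psi> ` X" and inj_psi: "inj_on \<psi> X"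
    using iden by (auto simp: identifies_quadrangular_algebras_def bij_betw_def)
  \<comment> \<open>From here on the matching equations are oriented so that rewriting pulls
    \<open>\<phi>\<close> and \<open>\<psi>\<close> outwards. Each primed term becomes the image of
    an unprimed one, to which the axioms of \<open>A\<close> apply.\<close>
  have phi_add: "\<phi> v + \<phi> w = \<phi> (v + w)" if "v \<in> L" "w \<in> L" for v w
    using iden that by (simp add: identifies_quadrangular_algebras_def linear_over_def)
  have phi_scale: "sL' c (\<phi> v) = \<phi> (sL c v)" if "c \<in> K" "v \<in> L" for c v
    using iden that by (simp add: identifies_quadrangular_algebras_def linear_over_def)
  have psi_add: "\<psi> x + \<psi> y = \<psi> (x + y)" if "x \<in> X" "y \<in> X" for x y
    using iden that by (simp add: identifies_quadrangular_algebras_def linear_over_def)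
  have psi_scale: "sX' c (\<psi> x) = \<psi> (sX c x)" if "c \<in> K" "x \<in> X" for c x
    using iden that by (simp add: identifies_quadrangular_algebras_def linear_over_def)
  have q': "q' (\<phi> v) = q v" if "v \<in> L" for v
    using iden that by (simp add: identifies_quadrangular_algebras_def)
  have one': "one' = \<phi> one"
    using iden by (simp add: identifies_quadrangular_algebras_def)
  have act': "act' (\<psi> x) (\<phi> v) = \<psi> (act x v)" if "x \<in> X" "v \<in> L" for x v
    using iden that by (simp add: identifies_quadrangular_algebras_def)
  have h': "h' (\<psi> x) (\<psi> y) = \<phi> (h x y)" if "x \<in> X" "y \<in> X" for x y
    using iden that by (simp add: identifies_quadrangular_algebras_def)
  have phi_zero: "\<phi> 0 = 0"
    using phi_add[OF A.L.zero_closed A.L.zero_closed] by simp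
  have psi_zero: "\<psi> 0 = 0"
    using psi_add[OF A.X.zero_closed A.X.zero_closed] by simp
  have phi_eq_zero: "\<phi> v = 0 \<longleftrightarrow> v = 0" if "v \<in> L" for v
    using inj_phi phi_zero that A.L.zero_closed by (metis inj_onD)
  have psi_eq_zero: "\<psi> x = 0 \<longleftrightarrow> x = 0" if "x \<in> X" for x
    using inj_psi psi_zero that A.X.zero_closed by (metis inj_onD)
  have phi_minus: "\<phi> v - \<phi> w = \<phi> (v - w)" if "v \<in> L" "w \<in> L" for v w
    using phi_add[of "v - w" w] A.L.add_closed[of v "- w"] A.L.uminus_closed[of w] that
    by (simp add: eq_diff_eq[symmetric])
  \<comment> \<open>The matching is known only on the carriers, so every rewrite needs its
    intermediate terms to lie there.\<close>
  have L_minus: "v - w \<in> L" if "v \<in> L" "w \<in> L" for v w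
    using A.L.add_closed[of v "- w"] A.L.uminus_closed[of w] that by simp
  have act_closed: "act x v \<in> X" if "x \<in> X" "v \<in> L" for x v
    using A.A1 that by (simp add: bilinear_over_def linear_over_def)
  have h_closed: "h x y \<in> L" if "x \<in> X" "y \<in> X" for x y
    using A.B1 that by (simp add: bilinear_over_def linear_over_def)
  have q_closed: "q v \<in> K" if "v \<in> L" for v
    using A.q_form that by (simp add: quadratic_form_over_def)
  have polar': "polar_form q' (\<phi> v) (\<phi> w) = polar_form q v w" if "v \<in> L" "w \<in> L" for v w
    using that by (simp add: polar_form_def phi_add q' A.L.add_closed)
  have polar_closed: "polar_form q v w \<in> K" if "v \<in> L" "w \<in> L" for v w
    using A.q_form that by (simp add: quadratic_form_over_def bilinear_over_def linear_over_def)
  have inverse_closed: "inverse c \<in> K" if "c \<in> K" for c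
    using A.L.subfield that by (simp add: is_subfield_def)
  have half_closed: "inverse 2 \<in> K"
    by (rule is_subfield_half[OF A.L.subfield])
  have sigma_closed: "qa_sigma sL q one v \<in> L" if "v \<in> L" for v
    using that by (simp add: qa_sigma_def L_minus A.L.scale_closed polar_closed A.one_closed)
  have sigma': "qa_sigma sL' q' (\<phi> one) (\<phi> v) = \<phi> (qa_sigma sL q one v)" if "v \<in> L" for v
    using that
    by (simp add: qa_sigma_def polar' polar_closed A.one_closed phi_scale phi_minus A.L.scale_closed)
  have qa_inv_closed: "qa_inverse sL q one v \<in> L" if "v \<in> L" for v
    using that by (simp add: qa_inverse_def A.L.scale_closed sigma_closed inverse_closed q_closed)
  have qa_inv': "qa_inverse sL' q' (\<phi> one) (\<phi> v) = \<phi> (qa_inverse sL q one v)" if "v \<in> L" for v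
    using that by (simp add: qa_inverse_def sigma' q' sigma_closed inverse_closed q_closed phi_scale)
  have theta_closed: "qa_theta sL act h x v \<in> L" if "x \<in> X" "v \<in> L" for x v
    using that by (simp add: qa_theta_def A.L.scale_closed half_closed h_closed act_closed)
  have theta': "qa_theta sL' act' h' (\<psi> x) (\<phi> v) = \<phi> (qa_theta sL act h x v)"
    if "x \<in> X" "v \<in> L" for x v
    using that by (simp add: qa_theta_def act' h' act_closed h_closed half_closed phi_scale)
  note closed = A.L.add_closed A.L.scale_closed A.X.add_closed A.X.scale_closed A.one_closed
    act_closed h_closed q_closed polar_closed qa_inv_closed theta_closed
  note transfer = phi_add phi_scale psi_add psi_scale q' act' h' polar' qa_inv' theta'
  show ?thesis
  proof
    show "(2 :: 'a) \<noteq> 0" by (fact A.char_not_2)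
    show "quadratic_form_over K L' sL' q'"
      using A.q_form
      by (simp add: quadratic_form_over_def bilinear_over_def linear_over_def L'_eq closed transfer)
    show "one' \<in> L'"
      by (simp add: one' L'_eq A.one_closed)
    show "q' one' = 1"
      by (simp add: one' q' A.one_closed A.q_one)
    show "\<exists>x\<in>X'. x \<noteq> 0"
      using A.nontrivial psi_eq_zero by (auto simp: X'_eq)
    show "bilinear_over K X' sX' L' sL' X' sX' act'"
      using A.A1 by (simp add: bilinear_over_def linear_over_def L'_eq X'_eq closed transfer)
    show "bilinear_over K X' sX' X' sX' L' sL' h'"
      using A.B1 by (simp add: bilinear_over_def linear_over_def L'_eq X'_eq closed transfer)
    show "v = 0" if "v \<in> L'" "q' v = 0" for v
      using that by (auto simp: L'_eq q' phi_eq_zero A.q_anisotropic)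
    show "act' x one' = x" if "x \<in> X'" for x
      using that by (auto simp: X'_eq one' act' A.one_closed A.A2)
    show "act' (act' x v) (qa_inverse sL' q' one' v) = x"
      if "x \<in> X'" "v \<in> L'" "v \<noteq> 0" for x v
      using that by (auto simp: L'_eq X'_eq one' closed transfer phi_eq_zero A.A3)
    show "h' x (act' y v) = h' y (act' x v) + sL' (polar_form q' (h' x y) one') v"
      if "x \<in> X'" "y \<in> X'" "v \<in> L'" for x y v
    proof -
      \<comment> \<open>(B2) exchanges \<open>x\<close> and \<open>y\<close>, so it would loop as a
        rewrite rule; it is instantiated and used from right to left.\<close>
      obtain a b w where "x = \<psi> a" "y = \<psi> b" "v = \<phi> w" "a \<in> X" "b \<in> X" "w \<in> L"
        using \<open>x \<in> X'\<close> \<open>y \<in> X'\<close> \<open>v \<in> L'\<close> by (auto simp: L'_eq X'_eq)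
      then show ?thesis
        by (simp add: one' closed transfer A.B2[of a b w, symmetric])
    qed
    show "polar_form q' (h' (act' x v) y) one' = polar_form q' (h' x y) v"
      if "x \<in> X'" "y \<in> X'" "v \<in> L'" for x y v
      using that by (auto simp: L'_eq X'_eq one' closed transfer A.B3)
    show "act' x (qa_theta sL' act' h' x v) = act' (act' x (qa_theta sL' act' h' x one')) v"
      if "x \<in> X'" "v \<in> L'" for x v
      using that by (auto simp: L'_eq X'_eq one' closed transfer A.D1[symmetric])
    show "qa_theta sL' act' h' x one' \<noteq> 0" if "x \<in> X'" "x \<noteq> 0" for x
      using that by (auto simp: X'_eq one' closed transfer phi_eq_zero psi_eq_zero A.D2)
  qed
qed

lemma bilinear_overI:
  assumes "\<And>v w. v \<in> V \<Longrightarrow> w \<in> W \<Longrightarrow> g v w \<in> Z"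
    and "\<And>v v' w. v \<in> V \<Longrightarrow> v' \<in> V \<Longrightarrow> w \<in> W \<Longrightarrow> g (v + v') w = g v w + g v' w"
    and "\<And>v w w'. v \<in> V \<Longrightarrow> w \<in> W \<Longrightarrow> w' \<in> W \<Longrightarrow> g v (w + w') = g v w + g v w'"
    and "\<And>c v w. c \<in> K \<Longrightarrow> v \<in> V \<Longrightarrow> w \<in> W \<Longrightarrow> g (sV c v) w = sZ c (g v w)"
    and "\<And>c v w. c \<in> K \<Longrightarrow> v \<in> V \<Longrightarrow> w \<in> W \<Longrightarrow> g v (sW c w) = sZ c (g v w)"
  shows "bilinear_over K V sV W sW Z sZ g"
  using assms by (simp add: bilinear_over_def linear_over_def)

section \<open>Hermitian matrices over a quadratic pair\<close>

lemma first_row_nth [simp]: "first_row x $ 1 = x" "first_row x $ 2 = 0"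
  by (simp_all add: first_row_def)

lemma mat2_nth [simp]:
  "mat2 a b c d $ 1 $ 1 = a" "mat2 a b c d $ 1 $ 2 = b"
  "mat2 a b c d $ 2 $ 1 = c" "mat2 a b c d $ 2 $ 2 = d"
  by (simp_all add: mat2_def)

lemma mat2_scale_nth [simp]: "mat2_scale c m $ i $ j = c * m $ i $ j"
  by (simp add: mat2_scale_def)

lemma row_scale_nth [simp]: "row_scale rscale c x $ i = rscale (x $ i) c"
  by (simp add: row_scale_def)

lemma row_act_nth [simp]:
  "row_act rscale j x $ n = rscale (x $ 1) (j $ 1 $ n) + rscale (x $ 2) (j $ 2 $ n)"
  by (simp add: row_act_def sum_2)

text \<open>A formula uniform in the indices lets the identities for \<open>row_beta\<close> be
  checked at a generic entry.\<close>

lemma row_beta_nth [simp]: "row_beta h x y $ i $ j = h (x $ i) (y $ j) - h (y $ i) (x $ j)"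
  using exhaust_2[of i] exhaust_2[of j] by (auto simp: row_beta_def)

lemma mat2_mult_nth: "((m :: 'l::semiring_1^2^2) ** n) $ i $ j = m $ i $ 1 * n $ 1 $ j + m $ i $ 2 * n $ 2 $ j"
  by (simp add: matrix_matrix_mult_def sum_2)

lemma mat2_add_rdistrib: "((a :: 'l::semiring_1^2^2) + b) ** c = a ** c + b ** c"
  by (simp add: vec_eq_iff mat2_mult_nth algebra_simps)

lemma mat2_scale_mult_left: "mat2_scale c m ** n = mat2_scale c (m ** n)"
  by (simp add: vec_eq_iff mat2_mult_nth algebra_simps)

text \<open>Scalars multiply entries from the left, so \<open>c\<close> has to pass the entries of
  \<open>m\<close>.\<close>

lemma mat2_scale_mult_right:
  assumes "\<And>l. c * l = l * c"
  shows "m ** mat2_scale c n = mat2_scale c (m ** n)"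
proof -
  have "a * (c * b) = c * (a * b)" for a b
    by (metis assms mult.assoc)
  then show ?thesis
    by (simp add: vec_eq_iff mat2_mult_nth distrib_left)
qed

lemma mat2_scale_add_right: "mat2_scale c (m + n) = mat2_scale c m + mat2_scale c n"
  by (simp add: vec_eq_iff distrib_left)

lemma mat2_scale_half_double:
  assumes "(2 :: 'l::division_ring) \<noteq> 0"
  shows "mat2_scale (inverse 2) (m + m) = (m :: 'l^2^2)"
proof -
  have "inverse 2 * (a + a) = a" for a :: 'l
    using assms by (simp add: mult_2[symmetric] mult.assoc[symmetric])
  then show ?thesis
    by (simp add: vec_eq_iff)
qed

text \<open>Common ground of the two kinds of quadratic pair, so that the commutative and the
  quaternion case are treated together.\<close>

locale central_involution =
  fixes \<sigma> :: "'l::division_ring \<Rightarrow> 'l"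
  assumes char_neq_2: "(2::'l) \<noteq> 0"
    and ring_inv: "ring_involution \<sigma>"
    and fixed_subfield: "is_subfield (fixed_set \<sigma>)"
    and fixed_central: "c \<in> fixed_set \<sigma> \<Longrightarrow> c * l = l * c"

lemma quadratic_pair_central_involution:
  assumes "quadratic_pair \<sigma>" "(2 :: 'l::division_ring) \<noteq> 0"
  shows "central_involution (\<sigma> :: 'l \<Rightarrow> 'l)"
proof
  show "ring_involution \<sigma>" "is_subfield (fixed_set \<sigma>)"
    using assms(1) unfolding quadratic_pair_def by blast+
  have "\<forall>c\<in>fixed_set \<sigma>. \<forall>l. c * l = l * c"
    using assms(1) unfolding quadratic_pair_def
  proof (elim conjE disjE)
    assume "separable_quadratic_field_extension (fixed_set \<sigma>)"
    then show ?thesis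
      unfolding separable_quadratic_field_extension_def by (elim conjE) simp
  next
    assume "quaternion_algebra_with_standard_involution (fixed_set \<sigma>) \<sigma>"
    then show ?thesis
      unfolding quaternion_algebra_with_standard_involution_def by (rule conjunct1)
  qed
  then show "c * l = l * c" if "c \<in> fixed_set \<sigma>" for c l
    using that by blast
qed (fact assms(2))

context central_involution
begin

abbreviation "k \<equiv> fixed_set \<sigma>"

section \<open>Norm and trace of the involution\<close>

lemma sigma_add [simp]: "\<sigma> (a + b) = \<sigma> a + \<sigma> b"
  and sigma_mult [simp]: "\<sigma> (a * b) = \<sigma> b * \<sigma> a"
  and sigma_sigma [simp]: "\<sigma> (\<sigma> a) = a"
  using ring_inv by (auto simp: ring_involution_def)

lemma sigma_zero [simp]: "\<sigma> 0 = 0"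
  using sigma_add[of 0 0] by simp

lemma sigma_one [simp]: "\<sigma> 1 = 1"
  using sigma_mult[of "\<sigma> 1" 1] by simp

lemma sigma_minus [simp]: "\<sigma> (- a) = - \<sigma> a"
  using sigma_add[of a "- a"] by (simp add: add_eq_0_iff)

lemma sigma_diff [simp]: "\<sigma> (a - b) = \<sigma> a - \<sigma> b"
  using sigma_add[of a "- b"] by simp

lemma sigma_fixed: "c \<in> k \<Longrightarrow> \<sigma> c = c"
  by (simp add: fixed_set_def)

lemma fixed_commute: "c \<in> k \<Longrightarrow> l * (c * l') = c * (l * l')"
  by (metis fixed_central mult.assoc)

lemma half_fixed: "inverse 2 \<in> k"
  by (rule is_subfield_half[OF fixed_subfield])

lemma norm_fixed: "a * \<sigma> a \<in> k"
  by (simp add: fixed_set_def)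

lemma norm_eq_zero_iff: "a * \<sigma> a = 0 \<longleftrightarrow> a = 0"
  by (metis mult_eq_0_iff sigma_sigma sigma_zero)

text \<open>The norm is fixed by \<open>\<sigma>\<close>, hence central: \<open>a * (\<sigma> a * a)
  = (a * \<sigma> a) * a = a * (a * \<sigma> a)\<close>, and a nonzero \<open>a\<close>
  cancels.\<close>

lemma norm_sigma: "\<sigma> a * a = a * \<sigma> a"
proof (cases "a = 0")
  case False
  have "a * (\<sigma> a * a) = a * (a * \<sigma> a)"
    by (simp add: fixed_central[OF norm_fixed] mult.assoc[symmetric])
  then show ?thesis
    using False by simp
qed simp

lemma polar_norm: "polar_form (norm_form \<sigma>) a b = a * \<sigma> b + b * \<sigma> a"
  by (simp add: polar_form_def norm_form_def algebra_simps)

text \<open>Polarisation: subtracting \<open>norm_sigma\<close> at \<open>a\<close> and at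
  \<open>b\<close> from \<open>norm_sigma\<close> at \<open>a + b\<close> leaves the mixed
  terms.\<close>

lemma polar_norm_sigma: "\<sigma> a * b + \<sigma> b * a = a * \<sigma> b + b * \<sigma> a"
  using norm_sigma[of "a + b"] norm_sigma[of a] norm_sigma[of b] by (simp add: algebra_simps)

text \<open>This replaces the parametrisation by three elements with a condition on a generic entry;
  the case of equal indices says that the diagonal is fixed.\<close>

lemma hermitian_iff: "m \<in> hermitian_mat2 \<sigma> \<longleftrightarrow> (\<forall>i j. \<sigma> (m $ i $ j) = m $ j $ i)"
proof
  assume "m \<in> hermitian_mat2 \<sigma>"
  then show "\<forall>i j. \<sigma> (m $ i $ j) = m $ j $ i"
    by (auto simp: hermitian_mat2_def fixed_set_def forall_2)
next
  assume *: "\<forall>i j. \<sigma> (m $ i $ j) = m $ j $ i"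
  then have "m = mat2 (m $ 1 $ 1) (\<sigma> (m $ 2 $ 1)) (m $ 2 $ 1) (m $ 2 $ 2)"
    by (simp add: vec_eq_iff forall_2)
  with * show "m \<in> hermitian_mat2 \<sigma>"
    unfolding hermitian_mat2_def fixed_set_def by blast
qed

text \<open>The equational laws hold for all matrices, so only closure remains to be checked for the
  hermitian matrices and for \<open>J_half\<close>.\<close>

lemma vector_space_mat:
  assumes "0 \<in> V" "\<And>v w. v \<in> V \<Longrightarrow> w \<in> V \<Longrightarrow> v + w \<in> V" "\<And>v. v \<in> V \<Longrightarrow> - v \<in> V"
    and "\<And>c v. c \<in> k \<Longrightarrow> v \<in> V \<Longrightarrow> mat2_scale c v \<in> V"
  shows "vector_space_over k V mat2_scale"
  by unfold_locales
    (use assms fixed_subfield in \<open>simp_all add: vec_eq_iff algebra_simps\<close>)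

text \<open>\<open>\<sigma>\<close> reverses products and moves \<open>c\<close> to the right;
  centrality brings it back.\<close>

lemma scale_hermitian:
  assumes c: "c \<in> k" and m: "m \<in> hermitian_mat2 \<sigma>"
  shows "mat2_scale c m \<in> hermitian_mat2 \<sigma>"
  using m by (simp add: hermitian_iff sigma_fixed[OF c] fixed_central[OF c])

lemma vector_space_hermitian: "vector_space_over k (hermitian_mat2 \<sigma>) mat2_scale"
  by (rule vector_space_mat, simp_all add: scale_hermitian) (simp_all add: hermitian_iff)

text \<open>Conjugate transposition reverses products, so it swaps \<open>m ** n\<close> and
  \<open>n ** m\<close> and fixes their sum.\<close>

lemma jmult_hermitian:
  assumes "m \<in> hermitian_mat2 \<sigma>" "n \<in> hermitian_mat2 \<sigma>"
  shows "mat2_jmult m n \<in> hermitian_mat2 \<sigma>"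
  unfolding mat2_jmult_def
  by (rule scale_hermitian[OF half_fixed])
    (use assms in \<open>simp add: hermitian_iff mat2_mult_nth add_ac\<close>)

lemma off_diag_add: "off_diag \<sigma> (a + b) = off_diag \<sigma> a + off_diag \<sigma> b"
  and off_diag_scale: "c \<in> k \<Longrightarrow> off_diag \<sigma> (c * a) = mat2_scale c (off_diag \<sigma> a)"
  and off_diag_minus: "off_diag \<sigma> (- a) = - off_diag \<sigma> a"
  and off_diag_zero: "off_diag \<sigma> 0 = 0"
  by (simp_all add: vec_eq_iff forall_2 off_diag_def sigma_fixed fixed_central)

lemma vector_space_J_half: "vector_space_over k (J_half \<sigma>) mat2_scale"
  by (rule vector_space_mat)
    (auto simp: J_half_def image_iff off_diag_add[symmetric] off_diag_scale[symmetric]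
      off_diag_minus[symmetric] intro: off_diag_zero)

section \<open>The Jordan structure on hermitian matrices\<close>

lemma mat2_jmult_self: "mat2_jmult m m = m ** (m :: 'l^2^2)"
  by (simp add: mat2_jmult_def mat2_scale_half_double[OF char_neq_2])

text \<open>Rewriting with these multiplies out Jordan products into sums of scaled, left-associated
  words.\<close>

lemmas mat2_expand = matrix_add_ldistrib mat2_add_rdistrib mat2_scale_mult_left
  mat2_scale_mult_right[OF fixed_central[OF half_fixed]] mat2_scale_add_right matrix_mul_assoc

text \<open>Twice \<open>j\<close> times (\<open>j\<close> times \<open>m\<close>) is half of
  \<open>jjm + 2jmj + mjj\<close>; subtracting the Jordan product of \<open>jj\<close> and
  \<open>m\<close>, which is half of \<open>jjm + mjj\<close>, leaves \<open>jmj\<close>.\<close>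

lemma jordan_U_mat2: "jordan_U mat2_jmult j m = j ** m ** (j :: 'l^2^2)"
proof -
  let ?s = "mat2_scale (inverse 2) :: 'l^2^2 \<Rightarrow> 'l^2^2"
  \<comment> \<open>To be used with \<open>a = jjm\<close>, \<open>b = jmj\<close>,
    \<open>c = mjj\<close>: the two middle words absorb the factor one half.\<close>
  have collect: "?s (a + b + (b + c)) = ?s (a + c) + b" for a b c
  proof -
    have "?s (a + b + (b + c)) = ?s (a + c) + ?s (b + b)"
      by (simp add: mat2_scale_add_right add_ac)
    then show ?thesis
      by (simp only: mat2_scale_half_double[OF char_neq_2])
  qed
  have "mat2_jmult j (mat2_jmult j m) + mat2_jmult j (mat2_jmult j m) =
      ?s (?s (j ** j ** m + j ** m ** j + (j ** m ** j + m ** j ** j)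
        + (j ** j ** m + j ** m ** j + (j ** m ** j + m ** j ** j))))"
    by (simp add: mat2_jmult_def mat2_expand)
  also have "\<dots> = ?s (j ** j ** m + m ** j ** j) + j ** m ** j"
    by (simp only: mat2_scale_half_double[OF char_neq_2] collect)
  finally show ?thesis
    unfolding jordan_U_def mat2_jmult_self
    by (simp add: mat2_jmult_def[of "j ** j"] matrix_mul_assoc)
qed

text \<open>Both sides expand to a quarter of \<open>mmnm + nmmm + mmmn + mnmm\<close>.\<close>

lemma jordan_identity_mat2:
  "mat2_jmult (mat2_jmult (mat2_jmult m m) n) m = mat2_jmult (mat2_jmult m m) (mat2_jmult n (m :: 'l^2^2))"
  unfolding mat2_jmult_self
  by (simp add: mat2_jmult_def mat2_expand add_ac)

lemma jordan_algebra_hermitian: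
  "jordan_algebra k (hermitian_mat2 \<sigma>) mat2_scale mat2_jmult (mat 1)"
proof -
  interpret H: vector_space_over k "hermitian_mat2 \<sigma>" mat2_scale
    by (fact vector_space_hermitian)
  have scale_commute: "mat2_scale (inverse 2) (mat2_scale c m) = mat2_scale c (mat2_scale (inverse 2) m)"
    if "c \<in> k" for c and m :: "'l^2^2"
    by (simp add: vec_eq_iff fixed_commute that)
  show ?thesis
  proof
    show "bilinear_over k (hermitian_mat2 \<sigma>) mat2_scale (hermitian_mat2 \<sigma>) mat2_scale
        (hermitian_mat2 \<sigma>) mat2_scale mat2_jmult"
    proof (rule bilinear_overI)
      fix c m n assume c: "c \<in> k"
      note mult = mat2_scale_mult_left mat2_scale_mult_right[OF fixed_central[OF c]]
      show "mat2_jmult (mat2_scale c m) n = mat2_scale c (mat2_jmult m n)"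
        by (simp add: mat2_jmult_def mult mat2_scale_add_right[symmetric] scale_commute[OF c])
      show "mat2_jmult n (mat2_scale c m) = mat2_scale c (mat2_jmult n m)"
        by (simp add: mat2_jmult_def mult mat2_scale_add_right[symmetric] scale_commute[OF c])
    qed (simp_all add: jmult_hermitian, simp_all add: mat2_jmult_def mat2_expand add_ac)
    show "mat 1 \<in> hermitian_mat2 \<sigma>"
      by (simp add: hermitian_iff mat_def)
    show "mat2_jmult (mat 1) m = m" for m :: "'l^2^2"
      by (simp add: mat2_jmult_def mat2_scale_half_double[OF char_neq_2])
    show "mat2_jmult m n = mat2_jmult n m" for m n :: "'l^2^2"
      by (simp add: mat2_jmult_def add.commute)
  qed (rule jordan_identity_mat2)
qed

end

section \<open>Anisotropic pseudo-quadratic spaces\<close>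

context right_vector_space
begin

lemma rscale_zero_left [simp]: "rscale 0 a = 0"
  using rscale_left_distrib[of 0 0 a] by simp

lemma rscale_zero_right [simp]: "rscale x 0 = 0"
  using rscale_right_distrib[of x 0 0] by simp

lemma first_row_add: "first_row (x + y) = first_row x + first_row y"
  and first_row_scale: "first_row (rscale x c) = row_scale rscale c (first_row x)"
  and first_row_minus: "first_row (- x) = - first_row x"
  and first_row_zero: "first_row 0 = 0"
  by (simp_all add: vec_eq_iff forall_2)

lemma row_act_one: "row_act rscale (mat 1) x = x"
  by (simp add: vec_eq_iff forall_2 mat_def rscale_one)

text \<open>Matrices act from the right, which reverses the order of composition. The palindrome
  \<open>jmj\<close> is unaffected, and this yields the module axiom for
  \<open>jordan_U\<close>.\<close>

lemma row_act_mult: "row_act rscale n (row_act rscale m x) = row_act rscale (m ** n) x"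
  by (simp add: vec_eq_iff mat2_mult_nth rscale_left_distrib rscale_right_distrib rscale_rscale add_ac)

end

locale central_pseudo_quadratic_space =
  standard_pseudo_quadratic_space rscale \<sigma> h \<pi> + central_involution \<sigma>
  for rscale :: "'x::ab_group_add \<Rightarrow> 'l::division_ring \<Rightarrow> 'x"
    and \<sigma> :: "'l \<Rightarrow> 'l" and h :: "'x \<Rightarrow> 'x \<Rightarrow> 'l" and \<pi> :: "'x \<Rightarrow> 'l" +
  assumes anisotropic: "anisotropic_pseudo_quadratic \<sigma> \<pi>"
begin

lemma h_zero_left [simp]: "h 0 x = 0"
  using h_add_left[of 0 0 x] by simp

lemma h_zero_right [simp]: "h x 0 = 0"
  using h_add_right[of x 0 0] by simp

text \<open>Apply \<open>\<sigma>\<close> to \<open>h y (rscale x a) = h y x * a\<close> and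
  exchange the arguments by skewness.\<close>

lemma h_rscale_left: "h (rscale x a) y = \<sigma> a * h x y"
proof -
  have "\<sigma> (h y (rscale x a)) = - (\<sigma> a * h x y)"
    by (simp only: h_rscale sigma_mult h_skew) simp
  then show ?thesis
    by (simp add: h_skew)
qed

text \<open>If \<open>h x x = 0\<close>, then \<open>\<pi> x = 0\<close> lies in the fixed field,
  and anisotropy gives \<open>x = 0\<close>.\<close>

lemma h_self_nonzero: "x \<noteq> 0 \<Longrightarrow> h x x \<noteq> 0"
  using anisotropic by (auto simp: anisotropic_pseudo_quadratic_def pi_eq fixed_set_def)

text \<open>Scalars act on rows from the right, so compatibility with products in \<open>k\<close>
  rests on centrality.\<close>

lemma vector_space_rows:
  assumes "0 \<in> V" "\<And>v w. v \<in> V \<Longrightarrow> w \<in> V \<Longrightarrow> v + w \<in> V" "\<And>v. v \<in> V \<Longrightarrow> - v \<in> V"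
    and "\<And>c v. c \<in> k \<Longrightarrow> v \<in> V \<Longrightarrow> row_scale rscale c v \<in> V"
  shows "vector_space_over k V (row_scale rscale)"
  by unfold_locales
    (use assms fixed_subfield in \<open>simp_all add: vec_eq_iff rscale_left_distrib rscale_right_distrib
      rscale_rscale rscale_one fixed_central\<close>)

lemma vector_space_row_zero_part: "vector_space_over k row_zero_part (row_scale rscale)"
  by (rule vector_space_rows)
    (auto simp: row_zero_part_def image_iff first_row_add[symmetric] first_row_scale[symmetric]
      first_row_minus[symmetric] intro: first_row_zero)

lemma special_jordan_module_rows:
  "special_jordan_module k (hermitian_mat2 \<sigma>) mat2_scale mat2_jmult (mat 1)
    UNIV (row_scale rscale) (row_act rscale)"
proof -
  interpret H: jordan_algebra k "hermitian_mat2 \<sigma>" mat2_scale mat2_jmult "mat 1"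
    by (fact jordan_algebra_hermitian)
  interpret X: vector_space_over k UNIV "row_scale rscale"
    by (rule vector_space_rows) simp_all
  show ?thesis
  proof
    show "bilinear_over k (hermitian_mat2 \<sigma>) mat2_scale UNIV (row_scale rscale) UNIV (row_scale rscale)
        (row_act rscale)"
    proof (rule bilinear_overI)
      fix c j x assume c: "c \<in> k"
      show "row_act rscale (mat2_scale c j) x = row_scale rscale c (row_act rscale j x)"
        by (simp add: vec_eq_iff rscale_left_distrib rscale_rscale fixed_central[OF c])
      show "row_act rscale j (row_scale rscale c x) = row_scale rscale c (row_act rscale j x)"
        by (simp add: vec_eq_iff rscale_left_distrib rscale_rscale fixed_central[OF c])
    qed (simp_all add: vec_eq_iff rscale_left_distrib rscale_right_distrib add_ac)
  qed (simp_all add: row_act_one row_act_mult jordan_U_mat2 matrix_mul_assoc)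
qed

section \<open>The form \<beta> and its compatibility with the action\<close>

lemma row_beta_hermitian: "row_beta h x y \<in> hermitian_mat2 \<sigma>"
  by (simp add: hermitian_iff h_skew)

lemma row_beta_bilinear:
  "bilinear_over k UNIV (row_scale rscale) UNIV (row_scale rscale) (hermitian_mat2 \<sigma>) mat2_scale
    (row_beta h)"
proof (rule bilinear_overI)
  fix c x y assume c: "c \<in> k"
  show "row_beta h (row_scale rscale c x) y = mat2_scale c (row_beta h x y)"
    by (simp add: vec_eq_iff h_rscale h_rscale_left sigma_fixed[OF c]
        fixed_central[OF c] left_diff_distrib)
  show "row_beta h x (row_scale rscale c y) = mat2_scale c (row_beta h x y)"
    by (simp add: vec_eq_iff h_rscale h_rscale_left sigma_fixed[OF c]
        fixed_central[OF c] left_diff_distrib)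
qed (simp_all add: row_beta_hermitian, simp_all add: vec_eq_iff h_add_left h_add_right)

lemma row_beta_skew: "row_beta h y x = - row_beta h x y"
  by (simp add: vec_eq_iff)

text \<open>Write \<open>H x y\<close> for the matrix with entries \<open>h (x $ a) (y $ b)\<close>,
  so that \<beta> is \<open>H x y - H y x\<close>. Sesquilinearity and
  \<open>\<sigma> (j $ m $ a) = j $ a $ m\<close> turn \<open>H\<close> of the two images under
  \<open>j\<close> into \<open>j ** H x y ** j\<close>.\<close>

lemma row_beta_act:
  assumes "j \<in> hermitian_mat2 \<sigma>"
  shows "row_beta h (row_act rscale j x) (row_act rscale j y) = j ** row_beta h x y ** j"
  using assms
  by (simp add: vec_eq_iff hermitian_iff mat2_mult_nth h_add_left h_add_right h_rscale h_rscale_left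
      algebra_simps)

text \<open>Acting on the first argument multiplies \<open>H\<close> by \<open>j\<close> on the
  left, acting on the second multiplies it on the right. The four terms of the sum regroup to
  \<open>j ** \<beta> + \<beta> ** j\<close>.\<close>

lemma row_beta_jmult:
  assumes "j \<in> hermitian_mat2 \<sigma>"
  shows "mat2_jmult j (row_beta h x y) = mat2_scale (inverse 2)
    (row_beta h (row_act rscale j x) y + row_beta h x (row_act rscale j y))"
  unfolding mat2_jmult_def
  by (rule arg_cong[of _ _ "mat2_scale (inverse 2)"])
    (use assms in \<open>simp add: vec_eq_iff hermitian_iff mat2_mult_nth h_add_left h_add_right h_rscale
      h_rscale_left algebra_simps\<close>)

text \<open>\<open>u_mat\<close> moves \<open>x\<close> to the second slot, and the entry
  \<open>a\<close> at (2, 1) brings it back as \<open>rscale x a\<close>.\<close>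

lemma row_act_off_diag_u:
  "row_act rscale (off_diag \<sigma> a) (row_act rscale u_mat (first_row x)) = first_row (rscale x a)"
  by (simp add: vec_eq_iff forall_2 off_diag_def u_mat_def rscale_one)

lemma row_beta_u: "row_beta h (row_act rscale u_mat (first_row x)) (first_row y) = off_diag \<sigma> (h x y)"
  by (simp add: vec_eq_iff forall_2 off_diag_def u_mat_def rscale_one h_skew)

lemma row_beta_off_diag:
  "row_beta h (row_act rscale (off_diag \<sigma> a) (first_row x)) (first_row x) = off_diag \<sigma> (a * h x x)"
  by (simp add: vec_eq_iff forall_2 off_diag_def h_skew h_rscale h_rscale_left)

text \<open>Both sides are the row with first entry 0 and second entry \<open>x\<close> times
  \<open>\<sigma> (a * h x x) = \<sigma> (h x x) * \<sigma> a\<close>.\<close>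

lemma row_beta_associative:
  "row_act rscale (row_beta h (row_act rscale (off_diag \<sigma> a) (first_row x)) (first_row x)) (first_row x)
    = row_act rscale (off_diag \<sigma> a) (row_act rscale u_mat (row_act rscale
        (row_beta h (row_act rscale u_mat (first_row x)) (first_row x)) (first_row x)))"
  unfolding row_beta_off_diag row_beta_u
  by (simp add: vec_eq_iff forall_2 off_diag_def u_mat_def rscale_one rscale_rscale)

section \<open>The quadrangular algebra on \<open>L\<close> and its identification with
  \<open>J_half\<close>\<close>

lemma quadrangular_algebra_scalar:
  assumes "\<exists>x::'x. x \<noteq> 0"
  shows "quadrangular_algebra k UNIV (*) UNIV (\<lambda>c x. rscale x c) (norm_form \<sigma>) 1 rscale h"
proof -
  interpret L: vector_space_over k UNIV "(*)"
    by unfold_locales (use fixed_subfield in \<open>simp_all add: algebra_simps\<close>)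
  interpret X: vector_space_over k UNIV "\<lambda>c x. rscale x c"
    by unfold_locales (use fixed_subfield in \<open>simp_all add: rscale_left_distrib rscale_right_distrib
      rscale_rscale rscale_one fixed_central\<close>)
  \<comment> \<open>The trace of \<open>v\<close> minus \<open>v\<close> is
    \<open>\<sigma> v\<close>, so the inverse of a quadrangular algebra is here the conjugate
    divided by the norm.\<close>
  have qa_inv: "qa_inverse (*) (norm_form \<sigma>) 1 v = inverse (v * \<sigma> v) * \<sigma> v" for v
    by (simp add: qa_inverse_def qa_sigma_def polar_norm norm_form_def)
  show ?thesis
  proof
    show "quadratic_form_over k UNIV (*) (norm_form \<sigma>)"
      unfolding quadratic_form_over_def
    proof (intro conjI ballI)
      fix c v assume c: "c \<in> k"
      show "norm_form \<sigma> (c * v) = c\<^sup>2 * norm_form \<sigma> v"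
        using fixed_central[OF c, of "v * \<sigma> v"]
        by (simp add: norm_form_def sigma_fixed[OF c] power2_eq_square mult.assoc)
    next
      show "bilinear_over k UNIV (*) UNIV (*) k (*) (polar_form (norm_form \<sigma>))"
        unfolding polar_norm
      proof (rule bilinear_overI)
        fix c v w assume c: "c \<in> k"
        have *: "c * v * \<sigma> w + w * \<sigma> (c * v) = c * (v * \<sigma> w + w * \<sigma> v)" for v w
          using fixed_central[OF c, of "w * \<sigma> v"]
          by (simp add: sigma_fixed[OF c] distrib_left mult.assoc)
        show "c * v * \<sigma> w + w * \<sigma> (c * v) = c * (v * \<sigma> w + w * \<sigma> v)"
          by (rule *)
        show "v * \<sigma> (c * w) + c * w * \<sigma> v = c * (v * \<sigma> w + w * \<sigma> v)"
          using *[of w v] by (simp only: add.commute)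
      qed (simp_all add: fixed_set_def algebra_simps)
    qed (simp add: norm_form_def norm_fixed)
    show "rscale (rscale x v) (qa_inverse (*) (norm_form \<sigma>) 1 v) = x" if "v \<noteq> 0" for x v
    proof -
      have "inverse (v * \<sigma> v) \<in> k"
        using fixed_subfield norm_fixed by (simp add: is_subfield_def)
      then have "v * (inverse (v * \<sigma> v) * \<sigma> v) = inverse (v * \<sigma> v) * (v * \<sigma> v)"
        by (rule fixed_commute)
      also have "\<dots> = 1"
        by (rule left_inverse) (simp only: norm_eq_zero_iff that not_False_eq_True)
      finally show ?thesis
        by (simp only: rscale_rscale qa_inv rscale_one)
    qed
    show "v = 0" if "norm_form \<sigma> v = 0" for v
      using that by (simp only: norm_form_def norm_eq_zero_iff)
    show "bilinear_over k UNIV (\<lambda>c x. rscale x c) UNIV (*) UNIV (\<lambda>c x. rscale x c) rscale"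
      by (rule bilinear_overI)
        (simp_all add: rscale_left_distrib rscale_right_distrib rscale_rscale, (metis fixed_central)+)
    show "bilinear_over k UNIV (\<lambda>c x. rscale x c) UNIV (\<lambda>c x. rscale x c) UNIV (*) h"
      by (rule bilinear_overI)
        (simp_all add: h_add_left h_add_right h_rscale h_rscale_left sigma_fixed fixed_central[symmetric])
    \<comment> \<open>The trace of \<open>h x y\<close> is \<open>h x y - h y x\<close> by
      skewness.\<close>
    show "h x (rscale y v) = h y (rscale x v) + polar_form (norm_form \<sigma>) (h x y) 1 * v" for x y v
      by (simp add: polar_norm h_rscale h_skew algebra_simps)
    show "polar_form (norm_form \<sigma>) (h (rscale x v) y) 1 = polar_form (norm_form \<sigma>) (h x y) v" for x y v
      using polar_norm_sigma[of v "h x y"] by (simp add: polar_norm h_rscale_left add_ac)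
    show "rscale x (qa_theta (*) rscale h x v) = rscale (rscale x (qa_theta (*) rscale h x 1)) v" for x v
      by (simp add: qa_theta_def h_rscale rscale_rscale mult.assoc)
    show "qa_theta (*) rscale h x 1 \<noteq> 0" if "x \<noteq> 0" for x
      using char_neq_2 h_self_nonzero[OF that] by (simp add: qa_theta_def rscale_one)
  qed (use assms in \<open>simp_all add: char_neq_2 norm_form_def rscale_one\<close>)
qed

text \<open>The target carriers are ranges by definition, so bijectivity amounts to recovering
  \<open>l\<close> from the entry (2, 1) and \<open>x\<close> from the first slot.\<close>

lemma identifies_scalar_J_half:
  "identifies_quadrangular_algebras k
     UNIV (*) UNIV (\<lambda>c x. rscale x c) (norm_form \<sigma>) 1 rscale h
     (J_half \<sigma>) mat2_scale row_zero_part (row_scale rscale) (Q_half \<sigma>) u_mat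
     (\<lambda>x v. row_act rscale v (row_act rscale u_mat x))
     (\<lambda>x y. row_beta h (row_act rscale u_mat x) y)
     (off_diag \<sigma>) first_row"
proof -
  have "inj (off_diag \<sigma>)"
    by (rule injI, drule arg_cong[of _ _ "\<lambda>m. m $ 2 $ 1"]) (simp add: off_diag_def)
  moreover have "inj (first_row :: 'x \<Rightarrow> 'x^2)"
    by (rule injI, drule arg_cong[of _ _ "\<lambda>x. x $ 1"]) simp
  moreover have "off_diag \<sigma> 1 = u_mat"
    by (simp add: off_diag_def u_mat_def)
  moreover have "Q_half \<sigma> (off_diag \<sigma> a) = norm_form \<sigma> a" for a
    by (simp add: Q_half_def off_diag_def)
  ultimately show ?thesis
    by (simp add: identifies_quadrangular_algebras_def bij_betw_def J_half_def row_zero_part_def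
        linear_over_def off_diag_add off_diag_scale first_row_add first_row_scale
        row_act_off_diag_u row_beta_u)
qed

end

theorem lemma3p10:
  fixes \<sigma> :: "'l::division_ring \<Rightarrow> 'l"
    and rscale :: "'x::ab_group_add \<Rightarrow> 'l \<Rightarrow> 'x"
    and h :: "'x \<Rightarrow> 'x \<Rightarrow> 'l" and \<pi> :: "'x \<Rightarrow> 'l"
    and k :: "'l set" and J :: "('l^2^2) set"
    and bullet :: "'l^2^2 \<Rightarrow> 'x^2 \<Rightarrow> 'x^2" (infixr "\<bullet>\<^sub>J" 70)
    and \<beta> :: "'x^2 \<Rightarrow> 'x^2 \<Rightarrow> 'l^2^2" and u :: "'l^2^2"
  assumes "quadratic_pair \<sigma>"
    and "(2::'l) \<noteq> 0"
    and "standard_pseudo_quadratic_space rscale \<sigma> h \<pi>"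
    and "anisotropic_pseudo_quadratic \<sigma> \<pi>"
    and "\<exists>x::'x. x \<noteq> 0"
    and k_eq: "k = fixed_set \<sigma>"
    and J_eq: "J = hermitian_mat2 \<sigma>"
    and bullet_eq: "bullet = row_act rscale"
    and beta_eq: "\<beta> = row_beta h"
    and u_eq: "u = u_mat"
  shows "special_jordan_module k J mat2_scale mat2_jmult (mat 1) UNIV (row_scale rscale) bullet \<and>
    (\<exists>x::'x^2. x \<noteq> 0) \<and>
    bilinear_over k UNIV (row_scale rscale) UNIV (row_scale rscale) J mat2_scale \<beta> \<and>
    (\<forall>x y. \<beta> y x = - \<beta> x y) \<and>
    (\<forall>j\<in>J. \<forall>x y. jordan_U mat2_jmult j (\<beta> x y) = \<beta> (j \<bullet>\<^sub>J x) (j \<bullet>\<^sub>J y)) \<and>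
    (\<forall>j\<in>J. \<forall>x y.
      mat2_jmult j (\<beta> x y) = mat2_scale (inverse 2) (\<beta> (j \<bullet>\<^sub>J x) y + \<beta> x (j \<bullet>\<^sub>J y))) \<and>
    (\<forall>x\<in>row_zero_part. \<forall>v\<in>J_half \<sigma>.
      \<beta> (v \<bullet>\<^sub>J x) x \<bullet>\<^sub>J x = v \<bullet>\<^sub>J u \<bullet>\<^sub>J \<beta> (u \<bullet>\<^sub>J x) x \<bullet>\<^sub>J x) \<and>
    (\<forall>x\<in>row_zero_part - {0}. \<beta> (u \<bullet>\<^sub>J x) x \<noteq> 0) \<and>
    quadrangular_algebra k UNIV (*) UNIV (\<lambda>c x. rscale x c) (norm_form \<sigma>) 1 rscale h \<and>
    quadrangular_algebra k (J_half \<sigma>) mat2_scale row_zero_part (row_scale rscale)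
      (Q_half \<sigma>) u (\<lambda>x v. v \<bullet>\<^sub>J u \<bullet>\<^sub>J x) (\<lambda>x y. \<beta> (u \<bullet>\<^sub>J x) y) \<and>
    identifies_quadrangular_algebras k
      UNIV (*) UNIV (\<lambda>c x. rscale x c) (norm_form \<sigma>) 1 rscale h
      (J_half \<sigma>) mat2_scale row_zero_part (row_scale rscale)
      (Q_half \<sigma>) u (\<lambda>x v. v \<bullet>\<^sub>J u \<bullet>\<^sub>J x) (\<lambda>x y. \<beta> (u \<bullet>\<^sub>J x) y)
      (off_diag \<sigma>) first_row"
proof -
  interpret central_pseudo_quadratic_space rscale \<sigma> h \<pi>
    using assms(1-4) quadratic_pair_central_involution
    by (auto simp: central_pseudo_quadratic_space_def central_pseudo_quadratic_space_axioms_def)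
  have qa: "quadrangular_algebra (fixed_set \<sigma>) UNIV (*) UNIV (\<lambda>c x. rscale x c) (norm_form \<sigma>) 1 rscale h"
    using assms(5) by (rule quadrangular_algebra_scalar)
  obtain x :: 'x where "x \<noteq> 0"
    using assms(5) by blast
  then have "first_row x $ 1 \<noteq> 0"
    by simp
  then have nontrivial: "\<exists>x::'x^2. x \<noteq> 0"
    using zero_index by metis
  have assoc: "row_act rscale (row_beta h (row_act rscale v x) x) x =
      row_act rscale v (row_act rscale u_mat
        (row_act rscale (row_beta h (row_act rscale u_mat x) x) x))"
    if "x \<in> row_zero_part" "v \<in> J_half \<sigma>" for x v
    using that row_beta_associative by (auto simp: row_zero_part_def J_half_def)
  \<comment> \<open>For \<open>x = first_row y\<close> the entry (2, 1) of this matrix is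
    \<open>h y y\<close>.\<close>
  have nonzero: "row_beta h (row_act rscale u_mat x) x \<noteq> 0" if "x \<in> row_zero_part - {0}" for x
  proof -
    obtain y where y: "x = first_row y"
      using \<open>x \<in> row_zero_part - {0}\<close> by (auto simp: row_zero_part_def)
    with that have "y \<noteq> 0"
      by (auto simp: first_row_zero)
    then have "off_diag \<sigma> (h y y) $ 2 $ 1 \<noteq> 0"
      using h_self_nonzero by (simp add: off_diag_def)
    then show ?thesis
      unfolding y row_beta_u by (metis zero_index)
  qed
  show ?thesis
    unfolding k_eq J_eq bullet_eq beta_eq u_eq
  proof (intro conjI ballI allI)
    show "jordan_U mat2_jmult j (row_beta h x y) = row_beta h (row_act rscale j x) (row_act rscale j y)"
      if "j \<in> hermitian_mat2 \<sigma>" for j x y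
      by (simp only: jordan_U_mat2 row_beta_act[OF that])
  qed (fact special_jordan_module_rows nontrivial row_beta_bilinear row_beta_skew row_beta_jmult
      assoc nonzero qa identifies_scalar_J_half
      quadrangular_algebra_transport[OF qa vector_space_J_half vector_space_row_zero_part
        identifies_scalar_J_half])+
qed

end
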